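(* For every $\epsilon>0$ there exist integers $n\ge 1$, $k\ge 2$, input parameters $\{\lambda_i\}_{i=1}^n,\{\mu_i\}_{i=1}^n,\{v_i\}_{i=1}^n$, and a feasible pair $(X,\boldsymbol\alpha)$ such that $$f(X,\boldsymbol\alpha)<\epsilon\, f(\bar X,\bar{\boldsymbol\alpha}),$$ where $(\bar X,\bar{\boldsymbol\alpha})$ is the (feasible) pooling decision $\bar{\boldsymbol\alpha}=(0,\dots,0,1)$ and $\bar X\in[0,1]^{n\times k}$ is the matrix whose last column is all ones and whose other columns are all zeros.
   Context: There are $n$ customer types and $k$ queues. Type $i$ customers arrive as a Poisson process with rate $\lambda_i>0$; their service time under a unit-capacity server is a nonnegative random variable $S_i$ with $\mathbb E[S_i]=1/\mu_i\in(0,\infty)$ and $\mathbb E[S_i^2]=v_i<\infty$. A partition is a vector $\boldsymbol\alpha=(\alpha_1,\dots,\alpha_k)$ with $\alpha_j\ge 0$ and $\sum_j\alpha_j=1$ ($\alpha_j$ is the capacity of queue $j$). An assignment is a matrix $X\in[0,1]^{n\times k}$ with $\sum_{j=1}^k X_{ij}=1$ for all $i$ ($X_{ij}$ is the probability that a type $i$ customer is sent to queue $j$). Let $R(\boldsymbol\alpha)=\{j:\alpha_j>0\}$. The pair $(X,\boldsymbol\alpha)$ is feasible if $\alpha_j>\sum_{i=1}^n\lambda_iX_{ij}/\mu_i$ for all $j\in R(\boldsymbol\alpha)$ and $X_{ij}=0$ for all $i$ whenever $\alpha_j=0$. The expected waiting time of a feasible pair is $$f(X,\boldsymbol\alpha)=\sum_{j\in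 R(\boldsymbol\alpha)}\left(\frac{\sum_{i=1}^n\lambda_iX_{ij}v_i}{\alpha_j^2-\alpha_j\sum_{i=1}^n\frac{\lambda_iX_{ij}}{\mu_i}}\cdot\frac{\sum_{i=1}^nX_{ij}\lambda_i}{2\sum_{i=1}^n\lambda_i}\right).$$ *)

theory Defs
  imports "HOL-Probability.Probability"
begin

text \<open>
  Customer types are indexed by \<open>{1..n}\<close> and queues by \<open>{1..k}\<close>; values of the parameter
  functions outside these ranges are irrelevant.  The arrival processes enter only through their
  rates \<open>lam i\<close>.  The service times are random variables \<open>S i\<close> on a probability space \<open>M\<close>, so
  \<open>mu\<close> and \<open>v\<close> are constrained to be the inverse mean and the second moment of an actual
  nonnegative random variable (in particular \<open>v i \<ge> 1 / (mu i)\<^sup>2\<close> necessarily holds).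
\<close>

definition input_params ::
    "nat \<Rightarrow> (nat \<Rightarrow> real) \<Rightarrow> (nat \<Rightarrow> real) \<Rightarrow> (nat \<Rightarrow> real) \<Rightarrow> 'w measure \<Rightarrow> (nat \<Rightarrow> 'w \<Rightarrow> real) \<Rightarrow> bool"
  where "input_params n lam mu v M S \<longleftrightarrow>
    prob_space M \<and>
    (\<forall>i\<in>{1..n}.
       lam i > 0 \<and> mu i > 0 \<and>
       S i \<in> borel_measurable M \<and>
       (\<forall>w\<in>space M. S i w \<ge> 0) \<and>
       integrable M (S i) \<and> (\<integral>w. S i w \<partial>M) = 1 / mu i \<and>
       integrable M (\<lambda>w. (S i w)\<^sup>2) \<and> (\<integral>w. (S i w)\<^sup>2 \<partial>M) = v i)"

definition is_partition :: "nat \<Rightarrow> (nat \<Rightarrow> real) \<Rightarrow> bool" where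
  "is_partition k \<alpha> \<longleftrightarrow> (\<forall>j\<in>{1..k}. \<alpha> j \<ge> 0) \<and> (\<Sum>j=1..k. \<alpha> j) = 1"

definition is_assignment :: "nat \<Rightarrow> nat \<Rightarrow> (nat \<Rightarrow> nat \<Rightarrow> real) \<Rightarrow> bool" where
  "is_assignment n k X \<longleftrightarrow>
    (\<forall>i\<in>{1..n}. \<forall>j\<in>{1..k}. X i j \<in> {0..1}) \<and> (\<forall>i\<in>{1..n}. (\<Sum>j=1..k. X i j) = 1)"

definition active_queues :: "nat \<Rightarrow> (nat \<Rightarrow> real) \<Rightarrow> nat set" where
  "active_queues k \<alpha> = {j\<in>{1..k}. \<alpha> j > 0}"

definition feasible ::
    "nat \<Rightarrow> nat \<Rightarrow> (nat \<Rightarrow> real) \<Rightarrow> (nat \<Rightarrow> real) \<Rightarrow> (nat \<Rightarrow> nat \<Rightarrow> real) \<Rightarrow> (nat \<Rightarrow> real) \<Rightarrow> bool"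
  where "feasible n k lam mu X \<alpha> \<longleftrightarrow>
    is_assignment n k X \<and> is_partition k \<alpha> \<and>
    (\<forall>j\<in>active_queues k \<alpha>. \<alpha> j > (\<Sum>i=1..n. lam i * X i j / mu i)) \<and>
    (\<forall>j\<in>{1..k}. \<alpha> j = 0 \<longrightarrow> (\<forall>i\<in>{1..n}. X i j = 0))"

definition expected_waiting_time ::
    "nat \<Rightarrow> nat \<Rightarrow> (nat \<Rightarrow> real) \<Rightarrow> (nat \<Rightarrow> real) \<Rightarrow> (nat \<Rightarrow> real) \<Rightarrow>
     (nat \<Rightarrow> nat \<Rightarrow> real) \<Rightarrow> (nat \<Rightarrow> real) \<Rightarrow> real"
  where "expected_waiting_time n k lam mu v X \<alpha> =
    (\<Sum>j\<in>active_queues k \<alpha>.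
       (\<Sum>i=1..n. lam i * X i j * v i)
         / ((\<alpha> j)\<^sup>2 - \<alpha> j * (\<Sum>i=1..n. lam i * X i j / mu i))
       * ((\<Sum>i=1..n. X i j * lam i) / (2 * (\<Sum>i=1..n. lam i))))"

definition pooling_partition :: "nat \<Rightarrow> nat \<Rightarrow> real" where
  "pooling_partition k = (\<lambda>j. if j = k then 1 else 0)"

definition pooling_assignment :: "nat \<Rightarrow> nat \<Rightarrow> nat \<Rightarrow> real" where
  "pooling_assignment k = (\<lambda>i j. if j = k then 1 else 0)"

end

theory Submission
  imports Defs
begin

text \<open>
  Take two types with deterministic service times \<open>1 / m\<close> and \<open>1\<close>, each bringing load \<open>1 / 4\<close>, so
  that almost all customers are short ones when \<open>m\<close> is large.  With a dedicated half-capacity queue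
  for each type the expected wait is \<open>2 / (m + 1)\<close>, whereas in the pooled queue everybody waits
  behind the long services and the expected wait is \<open>(1 + 1 / m) / 4\<close>.
\<close>

text \<open>A constant service time has second moment equal to its squared mean, the least value
  that Jensen's inequality permits for \<open>v i\<close>.\<close>

lemma input_params_deterministic:
  assumes "prob_space M" "\<And>i. i \<in> {1..n} \<Longrightarrow> lam i > 0" "\<And>i. i \<in> {1..n} \<Longrightarrow> mu i > 0"
  shows "input_params n lam mu (\<lambda>i. (1 / mu i)\<^sup>2) M (\<lambda>i _. 1 / mu i)"
proof -
  interpret prob_space M by fact
  show ?thesis
    unfolding input_params_def using assms by (auto simp: prob_space less_imp_le)
qed

lemma active_queues_pooling:
  assumes "k \<ge> 1"
  shows "active_queues k (pooling_partition k) = {k}"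
  using assms by (auto simp: active_queues_def pooling_partition_def)

lemma feasible_pooling:
  assumes "k \<ge> 1" "(\<Sum>i=1..n. lam i / mu i) < 1"
  shows "feasible n k lam mu (pooling_assignment k) (pooling_partition k)"
  using assms unfolding feasible_def active_queues_pooling[OF assms(1)]
  by (auto simp: is_assignment_def is_partition_def pooling_assignment_def pooling_partition_def)

text \<open>Every customer joins queue \<open>k\<close>, so the weight reduces to 1 / 2 and the
  Pollaczek-Khinchine mean wait of a single M/G/1 queue remains.\<close>

lemma expected_waiting_time_pooling:
  assumes "k \<ge> 1" "(\<Sum>i=1..n. lam i) > 0"
  shows "expected_waiting_time n k lam mu v (pooling_assignment k) (pooling_partition k)
    = (\<Sum>i=1..n. lam i * v i) / (2 * (1 - (\<Sum>i=1..n. lam i / mu i)))"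
  using assms unfolding expected_waiting_time_def active_queues_pooling[OF assms(1)]
  by (simp add: pooling_assignment_def pooling_partition_def)

theorem proposition1:
  fixes \<epsilon> :: real
  assumes "\<epsilon> > 0"
  shows "\<exists>(n::nat) (k::nat) lam mu v (M :: real measure) S X \<alpha>.
    n \<ge> 1 \<and> k \<ge> 2 \<and>
    input_params n lam mu v M S \<and>
    feasible n k lam mu X \<alpha> \<and>
    feasible n k lam mu (pooling_assignment k) (pooling_partition k) \<and>
    expected_waiting_time n k lam mu v X \<alpha>
      < \<epsilon> * expected_waiting_time n k lam mu v (pooling_assignment k) (pooling_partition k)"
proof -
  \<comment> \<open>Chosen so that \<epsilon> / 4 = 2 / m, the value that separates the two sides in
    the final chain.\<close>
  define m where "m = 8 / \<epsilon>"
  define mu :: "nat \<Rightarrow> real" where "mu i = (if i = 1 then m else 1)" for i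
  \<comment> \<open>Rates proportional to \<open>mu\<close> fix each load at 1 / 4, so every active
    queue is half utilised in both designs, whatever \<open>m\<close> is.\<close>
  define lam where "lam i = mu i / 4" for i
  define X :: "nat \<Rightarrow> nat \<Rightarrow> real" where "X i j = (if i = j then 1 else 0)" for i j
  define \<alpha> :: "nat \<Rightarrow> real" where "\<alpha> j = 1 / 2" for j
  let ?v = "\<lambda>i. (1 / mu i)\<^sup>2"
  have m: "m > 0" and \<epsilon>: "\<epsilon> = 8 / m"
    using assms by (auto simp: m_def)
  have two: "{1..2} = {1, 2 :: nat}" "{Suc 0..2} = {1, 2}" by auto
  have active: "active_queues 2 \<alpha> = {1, 2}"
    by (auto simp: active_queues_def \<alpha>_def)
  have params: "input_params 2 lam mu ?v (return borel (0 :: real)) (\<lambda>i _. 1 / mu i)"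
    using m by (intro input_params_deterministic prob_space_return) (auto simp: lam_def mu_def)
  have split_feasible: "feasible 2 2 lam mu X \<alpha>"
    using m unfolding feasible_def active is_assignment_def is_partition_def two
    by (auto simp: lam_def mu_def X_def \<alpha>_def)
  have pool_feasible: "feasible 2 2 lam mu (pooling_assignment 2) (pooling_partition 2)"
    using m by (intro feasible_pooling) (auto simp: two lam_def mu_def)
  \<comment> \<open>Each queue contributes 1 / (m + 1): the short type has factor 2 / m and weight m
    / (2 * (m + 1)), the long type factor 2 and weight 1 / (2 * (m + 1)).\<close>
  have split: "expected_waiting_time 2 2 lam mu ?v X \<alpha> = 2 / (m + 1)"
    using m unfolding expected_waiting_time_def active two
    by (simp add: lam_def mu_def X_def \<alpha>_def power2_eq_square flip: add_divide_distrib)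
      (simp add: field_simps)
  have pool: "expected_waiting_time 2 2 lam mu ?v (pooling_assignment 2) (pooling_partition 2)
      = (1 + 1 / m) / 4"
    using m by (subst expected_waiting_time_pooling)
      (auto simp: two lam_def mu_def field_simps power2_eq_square)
  have "2 / (m + 1) < 2 / m"
    using m by (simp add: field_simps)
  \<comment> \<open>The right-hand side equals (2 / m) * (1 + 1 / m).\<close>
  also have "\<dots> < \<epsilon> * ((1 + 1 / m) / 4)"
    using m by (simp add: \<epsilon> field_simps)
  finally have less: "expected_waiting_time 2 2 lam mu ?v X \<alpha>
      < \<epsilon> * expected_waiting_time 2 2 lam mu ?v (pooling_assignment 2) (pooling_partition 2)"
    unfolding split pool .
  show ?thesis
    by (rule exI[of _ 2], rule exI[of _ 2], rule exI[of _ lam], rule exI[of _ mu],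
        rule exI[of _ ?v], rule exI[of _ "return borel 0"],
        rule exI[of _ "\<lambda>i _. 1 / mu i"], rule exI[of _ X], rule exI[of _ \<alpha>])
      (use less params split_feasible pool_feasible in simp)
qed

end
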